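(* Let $r,s>0$. There is a $\tilde\pi_1(\mathbb{T}^n)$-trivial symplectic embedding $\phi:P^{2n}(s)\to Y^{2n}(r)$ such that for every $u\in\Delta^n(s)$, $\phi(\mathbb{T}^n\times\{u\})$ is a $C^\infty$ section in $T^*\mathbb{T}^n$ if and only if $s\le r$.
   Context: $\mathbb{T}^n=\mathbb{R}^n/\mathbb{Z}^n$, and $T^*\mathbb{T}^n=\mathbb{T}^n\times\mathbb{R}^n$ with its canonical symplectic form. $\Delta^n(r)\subset\mathbb{R}^n$ is the interior of the $n$-dimensional simplex with the $n+1$ vertices $(0,\ldots,0),(r,0,\ldots,0),\ldots,(0,\ldots,0,r)$. $P^{2n}(r)=\mathbb{T}^n\times\Delta^n(r)$ and $Y^{2n}(r)=\mathbb{T}^n\times(0,r)\times(\mathbb{R}^+)^{n-1}$, where $\mathbb{R}^+=(0,\infty)$. For open subsets $U,V\subset T^*M$, a symplectic embedding $\psi:U\to V$ is $\tilde\pi_1(M)$-trivial if $\psi_*\alpha=\alpha$ for every free homotopy class $\alpha\in[S^1,M]$ (loops in $T^*M$ being identified up to homotopy with loops in $M$ via projection). A subset of $T^*\mathbb{T}^n$ is a $C^\infty$ section if it has the form $\{(x,\sigma(x)):x\in\mathbb{T}^n\}$ with $\sigma$ a smooth one-form. *)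

theory Defs
  imports "HOL-Analysis.Analysis"
begin

subsection \<open>The torus and its cotangent bundle\<close>

definition lattice_rel :: "real ^ 'n \<Rightarrow> real ^ 'n \<Rightarrow> bool" where
  "lattice_rel x y \<longleftrightarrow> (\<forall>i. x $ i - y $ i \<in> \<int>)"

lemma equivp_lattice_rel: "equivp lattice_rel"
proof (rule equivpI)
  show "reflp lattice_rel"
    by (simp add: reflp_def lattice_rel_def)
  show "symp lattice_rel"
    unfolding symp_def lattice_rel_def by (metis Ints_minus minus_diff_eq)
  show "transp lattice_rel"
    unfolding transp_def lattice_rel_def
    by (metis (no_types, opaque_lifting) Ints_add diff_add_cancel add_diff_eq)
qed

quotient_type 'n torus = "real ^ ('n::finite)" / lattice_rel
  by (rule equivp_lattice_rel)

instantiation torus :: (finite) topological_space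
begin

text \<open>The quotient topology.\<close>

definition open_torus :: "'a torus set \<Rightarrow> bool" where
  "open_torus S \<longleftrightarrow> open (abs_torus -` S)"

instance
proof
  show "open (UNIV :: 'a torus set)"
    by (simp add: open_torus_def)
  show "open (S \<inter> T)" if "open S" "open T" for S T :: "'a torus set"
    using that by (simp add: open_torus_def open_Int)
  show "open (\<Union>K)" if "\<forall>S\<in>K. open S" for K :: "'a torus set set"
    using that by (auto simp: open_torus_def vimage_Union)
qed

end

text \<open>
  The cotangent bundle of the torus is \<open>'n torus \<times> (real ^ 'n)\<close>, the bundle projection is \<open>fst\<close>.
  The map below is its universal covering. It is a local diffeomorphism and defines the smooth
  structure; since lattice translations have derivative the identity, it also trivialises the
  tangent bundle, every tangent space being \<open>(real ^ 'n) \<times> (real ^ 'n)\<close>.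
\<close>

type_synonym 'n cotangent = "'n torus \<times> (real ^ 'n)"

definition cot_cover :: "(real ^ 'n) \<times> (real ^ 'n) \<Rightarrow> ('n::finite) cotangent" where
  "cot_cover z = (abs_torus (fst z), snd z)"

text \<open>The canonical symplectic form, the sum of all \<open>dx\<^sub>i \<and> dy\<^sub>i\<close>.\<close>

definition symplectic_form :: "(real ^ 'n) \<times> (real ^ 'n) \<Rightarrow> (real ^ 'n) \<times> (real ^ 'n) \<Rightarrow> real" where
  "symplectic_form v w = (\<Sum>i\<in>UNIV. fst v $ i * snd w $ i - snd v $ i * fst w $ i)"


subsection \<open>Smooth maps\<close>

text \<open>
  Maps of class \<open>C\<^sup>k\<close> on an open subset of a finite-dimensional space: all iterated
  directional derivatives up to order \<open>k\<close> exist and are continuous.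
\<close>

primrec Ck_on :: "nat \<Rightarrow> 'a::real_normed_vector set \<Rightarrow> ('a \<Rightarrow> 'b::real_normed_vector) \<Rightarrow> bool"
where
  "Ck_on 0 S f \<longleftrightarrow> continuous_on S f"
| "Ck_on (Suc k) S f \<longleftrightarrow>
     (\<forall>x\<in>S. f differentiable (at x)) \<and> (\<forall>v. Ck_on k S (\<lambda>x. frechet_derivative f (at x) v))"

definition smooth_on :: "'a::real_normed_vector set \<Rightarrow> ('a \<Rightarrow> 'b::real_normed_vector) \<Rightarrow> bool" where
  "smooth_on S f \<longleftrightarrow> (\<forall>k. Ck_on k S f)"

text \<open>
  A smooth representation, in the coordinates given by the covering, of a map \<open>\<phi>\<close> defined on the
  open set \<open>U\<close>, near the point \<open>cot_cover z\<close>.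
\<close>

definition smooth_lift_at ::
  "('n::finite) cotangent set \<Rightarrow> ('n cotangent \<Rightarrow> 'n cotangent) \<Rightarrow> (real ^ 'n) \<times> (real ^ 'n) \<Rightarrow>
     ((real ^ 'n) \<times> (real ^ 'n) \<Rightarrow> (real ^ 'n) \<times> (real ^ 'n)) \<Rightarrow> bool" where
  "smooth_lift_at U \<phi> z f \<longleftrightarrow>
     (\<exists>N. open N \<and> z \<in> N \<and> cot_cover ` N \<subseteq> U \<and> smooth_on N f \<and>
        (\<forall>w\<in>N. \<phi> (cot_cover w) = cot_cover (f w)))"

definition smooth_map ::
  "('n::finite) cotangent set \<Rightarrow> ('n cotangent \<Rightarrow> 'n cotangent) \<Rightarrow> bool" where
  "smooth_map U \<phi> \<longleftrightarrow> (\<forall>z. cot_cover z \<in> U \<longrightarrow> (\<exists>f. smooth_lift_at U \<phi> z f))"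

text \<open>
  For smooth \<open>\<phi>\<close> the linear map \<open>D\<close> is unique, because two local lifts differ by a locally
  constant lattice vector.
\<close>

definition has_tangent_map ::
  "('n::finite) cotangent set \<Rightarrow> ('n cotangent \<Rightarrow> 'n cotangent) \<Rightarrow> (real ^ 'n) \<times> (real ^ 'n) \<Rightarrow>
     ((real ^ 'n) \<times> (real ^ 'n) \<Rightarrow> (real ^ 'n) \<times> (real ^ 'n)) \<Rightarrow> bool" where
  "has_tangent_map U \<phi> z D \<longleftrightarrow> (\<exists>f. smooth_lift_at U \<phi> z f \<and> (f has_derivative D) (at z))"


subsection \<open>Symplectic embeddings, triviality on free homotopy classes, sections\<close>

definition smooth_embedding ::
  "('n::finite) cotangent set \<Rightarrow> 'n cotangent set \<Rightarrow> ('n cotangent \<Rightarrow> 'n cotangent) \<Rightarrow> bool" where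
  "smooth_embedding U V \<phi> \<longleftrightarrow>
     smooth_map U \<phi> \<and> \<phi> ` U \<subseteq> V \<and>
     (\<forall>z D. cot_cover z \<in> U \<longrightarrow> has_tangent_map U \<phi> z D \<longrightarrow> inj D) \<and>
     (\<exists>\<psi>. homeomorphism U (\<phi> ` U) \<phi> \<psi>)"

definition symplectic_embedding ::
  "('n::finite) cotangent set \<Rightarrow> 'n cotangent set \<Rightarrow> ('n cotangent \<Rightarrow> 'n cotangent) \<Rightarrow> bool" where
  "symplectic_embedding U V \<phi> \<longleftrightarrow>
     smooth_embedding U V \<phi> \<and>
     (\<forall>z D. cot_cover z \<in> U \<longrightarrow> has_tangent_map U \<phi> z D \<longrightarrow>
        (\<forall>v w. symplectic_form (D v) (D w) = symplectic_form v w))"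

text \<open>
  A loop in \<open>U\<close> represents the free homotopy class of its projection to the torus, and \<open>\<phi>\<close> sends
  this class to that of the projection of the image loop.
\<close>

definition pi1_trivial ::
  "('n::finite) cotangent set \<Rightarrow> ('n cotangent \<Rightarrow> 'n cotangent) \<Rightarrow> bool" where
  "pi1_trivial U \<phi> \<longleftrightarrow>
     (\<forall>\<gamma>. path \<gamma> \<and> path_image \<gamma> \<subseteq> U \<and> pathfinish \<gamma> = pathstart \<gamma> \<longrightarrow>
        homotopic_loops UNIV (fst \<circ> \<phi> \<circ> \<gamma>) (fst \<circ> \<gamma>))"

text \<open>A one-form on the torus is given by its coefficient vector in the global coframe \<open>dx\<^sub>i\<close>.\<close>

definition smooth_one_form :: "('n::finite torus \<Rightarrow> real ^ 'n) \<Rightarrow> bool" where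
  "smooth_one_form \<sigma> \<longleftrightarrow> smooth_on UNIV (\<lambda>x. \<sigma> (abs_torus x))"

definition smooth_section :: "('n::finite) cotangent set \<Rightarrow> bool" where
  "smooth_section A \<longleftrightarrow> (\<exists>\<sigma>. smooth_one_form \<sigma> \<and> A = {(x, \<sigma> x) |x. x \<in> UNIV})"


subsection \<open>The domains\<close>

definition open_simplex :: "real \<Rightarrow> (real ^ 'n) set" where
  "open_simplex r = interior (convex hull (insert 0 (range (\<lambda>i. axis i r))))"

definition P_domain :: "real \<Rightarrow> ('n::finite) cotangent set" where
  "P_domain r = UNIV \<times> open_simplex r"

text \<open>
  \<open>i\<close> is the index of the first coordinate; the order of the remaining coordinates is irrelevant.
\<close>

definition Y_domain :: "'n \<Rightarrow> real \<Rightarrow> ('n::finite) cotangent set" where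
  "Y_domain i r = UNIV \<times> {y. 0 < y $ i \<and> y $ i < r \<and> (\<forall>j. j \<noteq> i \<longrightarrow> 0 < y $ j)}"

end

theory Submission
  imports Defs
begin

text \<open>
  If \<open>s \<le> r\<close>, the inclusion is an embedding with all the required properties. For the converse, the
  sections are distinguished by their periods, and the point is that an embedding which is trivial
  on free homotopy classes translates all the periods by the same vector.

  Lift \<open>\<phi>\<close> to a map \<open>\<Phi>\<close> of \<open>\<real>\<^sup>n \<times> \<Delta>\<close>, where \<open>\<Delta>\<close> is the simplex (lemma \<open>cotangent_lift\<close>). Triviality on free
  homotopy classes means that \<open>\<Phi>\<close> commutes with lattice translations (lemma \<open>pi1_trivial_lift_periodic\<close>).
  For the Liouville form \<open>\<lambda> = \<Sum> y\<^sub>i dx\<^sub>i\<close> the form \<open>\<Phi>\<^sup>*\<lambda> - \<lambda>\<close> is closed, so on the convex set \<open>\<real>\<^sup>n \<times> \<Delta>\<close> it is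
  \<open>dH\<close> for some \<open>H\<close> (lemma \<open>symplectic_map_exact\<close>). It is also periodic, so \<open>H\<close> increases by a constant \<open>C\<close>
  under translation by the unit vector \<open>e\<^sub>i\<close> (lemma \<open>primitive_translation_constant\<close>).

  The image of the torus \<open>y = u\<close> is the graph of a one-form \<open>\<sigma>\<close>. It is Lagrangian, so \<open>\<sigma>\<close> is closed
  (lemma \<open>lagrangian_graph_symmetric\<close>). Its period in the direction \<open>e\<^sub>i\<close> is the integral of \<open>\<Phi>\<^sup>*\<lambda>\<close> over the loop
  \<open>x + t e\<^sub>i\<close> in the torus \<open>y = u\<close>, which is \<open>C + u $ i\<close>. By the mean value theorem the period is a value
  of the component of \<open>\<sigma>\<close> in the direction \<open>e\<^sub>i\<close> (lemma \<open>lagrangian_section_flux\<close>), and it lies in \<open>(0, r)\<close> because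
  the graph lies in \<open>T\<^sup>n \<times> (0, r) \<times> (0, \<infinity>)\<^sup>n\<^sup>-\<^sup>1\<close>. As \<open>u $ i\<close> takes all values in \<open>(0, s)\<close>, an
  interval of length \<open>s\<close> fits into one of length \<open>r\<close>.

  Two tools from analysis are developed on the way: symmetry of second derivatives and the Poincare lemma
  for one-forms on convex sets.
\<close>

section \<open>Symmetry of second derivatives and exactness of closed one-forms\<close>

text \<open>
  The mean value theorem in the direction \<open>h\<close>, applied to a difference in the direction \<open>k\<close>, followed
  by the mean value theorem in the direction \<open>k\<close>. The left-hand side is symmetric in \<open>h\<close> and \<open>k\<close>
  while the right-hand side is a second derivative taken in one particular order; this is what
  makes mixed derivatives commute.
\<close>

lemma second_difference_mean_value:
  fixes f :: "'a::real_normed_vector \<Rightarrow> real"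
  assumes f: "\<And>z. z \<in> S \<Longrightarrow> (f has_derivative f' z) (at z)"
    and fh: "\<And>z. z \<in> S \<Longrightarrow> ((\<lambda>z. f' z h) has_derivative Dh z) (at z)"
    and S: "\<And>s t. s \<in> {0..e} \<Longrightarrow> t \<in> {0..e} \<Longrightarrow> z + s *\<^sub>R h + t *\<^sub>R k \<in> S"
    and e: "0 \<le> e"
  obtains s t where "s \<in> {0..e}" "t \<in> {0..e}"
    "f (z + e *\<^sub>R h + e *\<^sub>R k) - f (z + e *\<^sub>R h) - f (z + e *\<^sub>R k) + f z
      = e * (e * Dh (z + s *\<^sub>R h + t *\<^sub>R k) k)"
proof -
  define q where "q s = f (z + s *\<^sub>R h + e *\<^sub>R k) - f (z + s *\<^sub>R h + 0 *\<^sub>R k)" for s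
  have dq: "(q has_derivative (\<lambda>d. d * (f' (z + s *\<^sub>R h + e *\<^sub>R k) h - f' (z + s *\<^sub>R h + 0 *\<^sub>R k) h)))
      (at s within {0..e})" if "0 \<le> s" "s \<le> e" for s
  proof -
    have D: "((\<lambda>s. f (z + s *\<^sub>R h + t *\<^sub>R k)) has_derivative (\<lambda>d. d * f' (z + s *\<^sub>R h + t *\<^sub>R k) h))
        (at s within {0..e})" if t: "t \<in> {0..e}" for t
    proof -
      have *: "z + s *\<^sub>R h + t *\<^sub>R k \<in> S" using S t that \<open>0 \<le> s\<close> \<open>s \<le> e\<close> by auto
      have "((\<lambda>s. f (z + s *\<^sub>R h + t *\<^sub>R k)) has_derivative (\<lambda>d. f' (z + s *\<^sub>R h + t *\<^sub>R k) (d *\<^sub>R h)))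
        (at s within {0..e})"
        by (rule has_derivative_compose[where f = "\<lambda>s. z + s *\<^sub>R h + t *\<^sub>R k" and g = f, OF _ f[OF *]])
           (auto intro!: derivative_eq_intros)
      then show ?thesis
        using linear_scale[OF has_derivative_linear[OF f[OF *]]] by simp
    qed
    show ?thesis
      unfolding q_def right_diff_distrib
      by (intro has_derivative_diff D) (use e in auto)
  qed
  obtain s where s: "s \<in> {0..e}"
    and qs: "q e - q 0 = (e - 0) * (f' (z + s *\<^sub>R h + e *\<^sub>R k) h - f' (z + s *\<^sub>R h + 0 *\<^sub>R k) h)"
    using mvt_very_simple[OF e dq] by metis
  have dp: "((\<lambda>t. f' (z + s *\<^sub>R h + t *\<^sub>R k) h) has_derivative (\<lambda>d. d * Dh (z + s *\<^sub>R h + t *\<^sub>R k) k))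
      (at t within {0..e})" if "0 \<le> t" "t \<le> e" for t
  proof -
    have *: "z + s *\<^sub>R h + t *\<^sub>R k \<in> S" using S s that by auto
    have "((\<lambda>t. f' (z + s *\<^sub>R h + t *\<^sub>R k) h) has_derivative (\<lambda>d. Dh (z + s *\<^sub>R h + t *\<^sub>R k) (d *\<^sub>R k)))
      (at t within {0..e})"
      by (rule has_derivative_compose[where f = "\<lambda>t. z + s *\<^sub>R h + t *\<^sub>R k" and g = "\<lambda>z. f' z h", OF _ fh[OF *]])
         (auto intro!: derivative_eq_intros)
    then show ?thesis
      using linear_scale[OF has_derivative_linear[OF fh[OF *]]] by simp
  qed
  obtain t where t: "t \<in> {0..e}"
    and ps: "f' (z + s *\<^sub>R h + e *\<^sub>R k) h - f' (z + s *\<^sub>R h + 0 *\<^sub>R k) h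
      = (e - 0) * Dh (z + s *\<^sub>R h + t *\<^sub>R k) k"
    using mvt_very_simple[OF e dp] by metis
  show thesis
    using that[OF s t] qs ps by (simp add: q_def algebra_simps)
qed

text \<open>
  The second difference over a small parallelogram at \<open>z\<close>, divided by \<open>e\<^sup>2\<close>, is a value near \<open>z\<close> of
  either mixed derivative; by continuity both limits are attained at \<open>z\<close>.
\<close>

lemma symmetric_second_derivative_real:
  fixes f :: "'a::real_normed_vector \<Rightarrow> real"
  assumes "open S" "z \<in> S"
    and f: "\<And>z. z \<in> S \<Longrightarrow> (f has_derivative f' z) (at z)"
    and fh: "\<And>z. z \<in> S \<Longrightarrow> ((\<lambda>z. f' z h) has_derivative Dh z) (at z)"
    and fk: "\<And>z. z \<in> S \<Longrightarrow> ((\<lambda>z. f' z k) has_derivative Dk z) (at z)"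
    and ch: "continuous_on S (\<lambda>z. Dh z k)" and ck: "continuous_on S (\<lambda>z. Dk z h)"
  shows "Dh z k = Dk z h"
proof -
  have "\<bar>Dh z k - Dk z h\<bar> \<le> \<epsilon>" if "\<epsilon> > 0" for \<epsilon> :: real
  proof -
    have "isCont (\<lambda>z. Dh z k) z" "isCont (\<lambda>z. Dk z h) z"
      using assms continuous_on_eq_continuous_at by blast+
    then obtain d1 d2 where d1: "d1 > 0" "\<And>w. dist w z < d1 \<Longrightarrow> dist (Dh w k) (Dh z k) < \<epsilon>/2"
      and d2: "d2 > 0" "\<And>w. dist w z < d2 \<Longrightarrow> dist (Dk w h) (Dk z h) < \<epsilon>/2"
      unfolding continuous_at_eps_delta using \<open>\<epsilon> > 0\<close> by (metis half_gt_zero)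
    obtain d3 where d3: "d3 > 0" "ball z d3 \<subseteq> S"
      using assms openE by blast
    define d where "d = min d1 (min d2 d3)"
    have "d > 0" using d1 d2 d3 by (simp add: d_def)
    \<comment> \<open>Small enough for the parallelogram with sides \<open>e *\<^sub>R h\<close> and \<open>e *\<^sub>R k\<close> to stay in the ball of radius \<open>d\<close>.\<close>
    define e where "e = d / (2 * (norm h + norm k + 1))"
    have e: "e > 0" using \<open>d > 0\<close> by (simp add: e_def add_nonneg_pos)
    have close: "dist (z + s *\<^sub>R h + t *\<^sub>R k) z < d" if "s \<in> {0..e}" "t \<in> {0..e}" for s t
    proof -
      have "dist (z + s *\<^sub>R h + t *\<^sub>R k) z = norm (s *\<^sub>R h + t *\<^sub>R k)"
        by (simp add: dist_norm algebra_simps)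
      also have "\<dots> \<le> s * norm h + t * norm k"
        using that norm_triangle_ineq[of "s *\<^sub>R h" "t *\<^sub>R k"] by simp
      also have "\<dots> \<le> e * norm h + e * norm k"
        using that by (intro add_mono mult_right_mono) auto
      also have "\<dots> < e * (2 * (norm h + norm k + 1))"
        using e by (simp add: algebra_simps add_strict_increasing2)
      also have "\<dots> = d" 
        unfolding e_def by (simp add: add_nonneg_pos less_imp_neq[THEN not_sym])
      finally show ?thesis .
    qed
    have inS: "z + s *\<^sub>R h + t *\<^sub>R k \<in> S" if "s \<in> {0..e}" "t \<in> {0..e}" for s t
      using close[OF that] d3 by (auto simp: d_def dist_commute subset_iff)
    have inS': "z + s *\<^sub>R k + t *\<^sub>R h \<in> S" if "s \<in> {0..e}" "t \<in> {0..e}" for s t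
      using inS[of t s] that by (simp add: algebra_simps)
    obtain s t where st: "s \<in> {0..e}" "t \<in> {0..e}"
      and 1: "f (z + e *\<^sub>R h + e *\<^sub>R k) - f (z + e *\<^sub>R h) - f (z + e *\<^sub>R k) + f z
      = e * (e * Dh (z + s *\<^sub>R h + t *\<^sub>R k) k)"
      by (rule second_difference_mean_value[of S f f' h Dh e z k])
        (use f fh inS e in auto)
    obtain s' t' where st': "s' \<in> {0..e}" "t' \<in> {0..e}"
      and 2: "f (z + e *\<^sub>R k + e *\<^sub>R h) - f (z + e *\<^sub>R k) - f (z + e *\<^sub>R h) + f z
      = e * (e * Dk (z + s' *\<^sub>R k + t' *\<^sub>R h) h)"
      by (rule second_difference_mean_value[of S f f' k Dk e z h])
        (use f fk inS' e in auto)
    have "Dh (z + s *\<^sub>R h + t *\<^sub>R k) k = Dk (z + t' *\<^sub>R h + s' *\<^sub>R k) h"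
      using 1 2 e by (simp add: algebra_simps)
    moreover have "dist (Dh (z + s *\<^sub>R h + t *\<^sub>R k) k) (Dh z k) < \<epsilon>/2"
      using close[OF st] by (intro d1) (simp add: d_def)
    moreover have "dist (Dk (z + t' *\<^sub>R h + s' *\<^sub>R k) h) (Dk z h) < \<epsilon>/2"
      using close[OF st'(2,1)] by (intro d2) (simp add: d_def)
    ultimately show ?thesis unfolding dist_real_def by linarith
  qed
  then have "\<bar>Dh z k - Dk z h\<bar> \<le> 0"
    by (rule field_le_epsilon[of _ 0, simplified add_0]) 
  then show ?thesis by simp
qed

lemma symmetric_second_derivative:
  fixes f :: "'a::real_normed_vector \<Rightarrow> 'b::euclidean_space"
  assumes "open S" "z \<in> S"
    and f: "\<And>z. z \<in> S \<Longrightarrow> (f has_derivative f' z) (at z)"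
    and f': "\<And>h z. z \<in> S \<Longrightarrow> ((\<lambda>z. f' z h) has_derivative f'' z h) (at z)"
    and cont: "\<And>h k. continuous_on S (\<lambda>z. f'' z h k)"
  shows "f'' z h k = f'' z k h"
proof (rule euclidean_eqI)
  fix c :: 'b assume "c \<in> Basis"
  show "f'' z h k \<bullet> c = f'' z k h \<bullet> c"
    by (rule symmetric_second_derivative_real[where S = S and f = "\<lambda>z. f z \<bullet> c"
          and f' = "\<lambda>z v. f' z v \<bullet> c" and Dh = "\<lambda>z v. f'' z h v \<bullet> c" and Dk = "\<lambda>z v. f'' z k v \<bullet> c"])
      (use assms in \<open>auto intro!: has_derivative_inner_left continuous_intros\<close>)
qed

text \<open>
  The Poincare lemma for one-forms. The form \<open>\<alpha>\<close> has directional derivatives \<open>\<beta> z h k\<close> (the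
  coefficient of \<open>h\<close>, differentiated along \<open>k\<close>), and closedness is their symmetry. The primitive is
  the integral of \<open>\<alpha>\<close> along the segments from a base point; closedness turns the derivative of
  the integrand into the total derivative of \<open>t * \<alpha> (x0 + t *\<^sub>R (x - x0)) k\<close> with respect to \<open>t\<close>.
\<close>

lemma closed_form_exact_on_convex:
  fixes \<alpha> :: "'a::euclidean_space \<Rightarrow> 'a \<Rightarrow> real"
  assumes S: "open S" "convex S"
    and lin: "\<And>z. z \<in> S \<Longrightarrow> linear (\<alpha> z)"
    and deriv: "\<And>z h. z \<in> S \<Longrightarrow> ((\<lambda>z. \<alpha> z h) has_derivative \<beta> z h) (at z)"
    and sym: "\<And>z h k. z \<in> S \<Longrightarrow> \<beta> z h k = \<beta> z k h"
    and cont: "\<And>h k. continuous_on S (\<lambda>z. \<beta> z h k)"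
  shows "\<exists>g. \<forall>z\<in>S. (g has_derivative \<alpha> z) (at z)"
proof (cases "S = {}")
  case False
  then obtain x0 where x0: "x0 \<in> S" by auto
  define p where "p x t = x0 + t *\<^sub>R (x - x0)" for x :: 'a and t :: real
  have pS: "p x t \<in> S" if "x \<in> S" "t \<in> {0..1}" for x t
  proof -
    have "p x t = (1 - t) *\<^sub>R x0 + t *\<^sub>R x" by (simp add: p_def algebra_simps)
    then show ?thesis using S(2) x0 that unfolding convex_alt by auto
  qed
  have linb: "linear (\<beta> z h)" if "z \<in> S" for z h
    using deriv[OF that] has_derivative_linear by blast
  have linb': "linear (\<lambda>h. \<beta> z h k)" if "z \<in> S" for z k
    using linb[OF that, of k] unfolding sym[OF that, of k] .
  have expand: "A (x::'a) = (\<Sum>b\<in>Basis. (x \<bullet> b) * A b)" if "linear A" for A :: "'a \<Rightarrow> real" and x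
    by (subst euclidean_representation[of x, symmetric])
      (simp only: linear_sum[OF that] linear_scale[OF that] real_scaleR_def)
  have cont\<alpha>: "continuous_on S (\<lambda>z. \<alpha> z h)" for h
    using has_derivative_continuous[OF deriv] by (intro continuous_at_imp_continuous_on ballI)
  \<comment> \<open>The integrand along the segment, and its derivative with respect to the end point \<open>x\<close>.\<close>
  define F where "F x t = \<alpha> (p x t) (x - x0)" for x t
  define F' where "F' x t k = \<alpha> (p x t) k + t * \<beta> (p x t) (x - x0) k" for x t k
  have F'_bl: "bounded_linear (F' x t)" if "x \<in> S" "t \<in> {0..1}" for x t
    unfolding linear_conv_bounded_linear[symmetric] F'_def
    using lin[OF pS[OF that]] linb[OF pS[OF that]]
    by (intro linearI) (simp_all add: linear_add linear_scale algebra_simps)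
  have contp: "continuous_on (S \<times> {0..1}) (\<lambda>(x,t). p x t)"
    unfolding p_def split_beta by (intro continuous_intros)
  have cont_comp: "continuous_on (S \<times> {0..1}) (\<lambda>(x,t). G (p x t))"
    if "continuous_on S G" for G :: "'a \<Rightarrow> real"
    unfolding split_beta
    by (rule continuous_on_compose2[OF that contp[unfolded split_beta]]) (use pS in auto)
  \<comment> \<open>Continuity is assumed for fixed directions only, so the direction \<open>x - x0\<close>, which moves with \<open>x\<close>,
    is expanded in the basis.\<close>
  have cont_F': "continuous_on (S \<times> {0..1}) (\<lambda>(x,t). F' x t k)" for k
  proof -
    have "continuous_on (S \<times> {0..1}) (\<lambda>(x,t). \<alpha> (p x t) k + t * (\<Sum>b\<in>Basis. ((x - x0) \<bullet> b) * \<beta> (p x t) b k))"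
      using cont_comp[OF cont\<alpha>] cont_comp[OF cont] unfolding split_beta
      by (intro continuous_intros)
    then show ?thesis
      by (rule continuous_on_eq) (auto simp: F'_def expand[OF linb'[OF pS]])
  qed
  have cont_F: "continuous_on (S \<times> {0..1}) (\<lambda>(x,t). F x t)"
  proof -
    have "continuous_on (S \<times> {0..1}) (\<lambda>(x,t). \<Sum>b\<in>Basis. ((x - x0) \<bullet> b) * \<alpha> (p x t) b)"
      using cont_comp[OF cont\<alpha>] unfolding split_beta
      by (intro continuous_intros)
    then show ?thesis
      by (rule continuous_on_eq) (auto simp: F_def expand[OF lin[OF pS]])
  qed
  have dF: "((\<lambda>x. F x t) has_derivative F' x t) (at x within S)" if "x \<in> S" "t \<in> {0..1}" for x t
  proof -
    note z = pS[OF that]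
    have dp: "((\<lambda>x. p x t) has_derivative (\<lambda>k. t *\<^sub>R k)) (at x within S)"
      unfolding p_def by (auto intro!: derivative_eq_intros)
    have "((\<lambda>x. \<alpha> (p x t) b) has_derivative (\<lambda>k. \<beta> (p x t) b (t *\<^sub>R k))) (at x within S)" for b
      by (rule has_derivative_compose[OF dp deriv[OF z]])
    then have "((\<lambda>x. \<Sum>b\<in>Basis. ((x - x0) \<bullet> b) * \<alpha> (p x t) b) has_derivative
       (\<lambda>k. \<Sum>b\<in>Basis. ((x - x0) \<bullet> b) * \<beta> (p x t) b (t *\<^sub>R k) + (k \<bullet> b) * \<alpha> (p x t) b)) (at x within S)"
      by (intro has_derivative_sum has_derivative_mult) (auto intro!: derivative_eq_intros)
    moreover have "(\<lambda>k. \<Sum>b\<in>Basis. ((x - x0) \<bullet> b) * \<beta> (p x t) b (t *\<^sub>R k) + (k \<bullet> b) * \<alpha> (p x t) b) = F' x t"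
      by (auto simp: F'_def fun_eq_iff sum.distrib expand[OF linb'[OF z], of "x - x0"]
          linear_scale[OF linb[OF z]] sum_distrib_left mult.left_commute
          expand[OF lin[OF z], symmetric])
    ultimately show ?thesis
      by (rule has_derivative_transform[OF that(1), rotated 1, OF has_derivative_eq_rhs])
        (auto simp: F_def expand[OF lin[OF pS[OF _ that(2)]]])
  qed
  define B where "B x t = Blinfun (F' x t)" for x t
  have B: "blinfun_apply (B x t) = F' x t" if "x \<in> S" "t \<in> {0..1}" for x t
    unfolding B_def by (rule bounded_linear_Blinfun_apply[OF F'_bl[OF that]])
  define g where "g x = integral {0..1} (F x)" for x
  have "(g has_derivative \<alpha> x) (at x)" if x: "x \<in> S" for x
  proof -
    have contB: "continuous_on (S \<times> {0..1}) (\<lambda>(x,t). B x t)"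
      by (rule continuous_on_blinfun_componentwise)
        (rule continuous_on_eq[OF cont_F'], auto simp: B)
    have Fint: "F y integrable_on cbox 0 1" if "y \<in> S" for y
    proof -
      have "continuous_on {0..1} (\<lambda>t. case (y,t) of (x,t) \<Rightarrow> F x t)"
        by (rule continuous_on_compose2[OF cont_F]) (use that in \<open>auto intro!: continuous_intros\<close>)
      then show ?thesis by (simp add: integrable_continuous_interval)
    qed
    have main: "((\<lambda>x. integral (cbox 0 1) (F x)) has_derivative
        blinfun_apply (integral (cbox 0 1) (B x))) (at x within S)"
      by (rule leibniz_rule[where U = S])
        (use dF B contB Fint S x in \<open>auto simp: box_real\<close>)
    have "blinfun_apply (integral (cbox 0 1) (B x)) k = \<alpha> x k" for k
    proof -
      have Bx: "B x integrable_on cbox 0 1"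
      proof -
        have "continuous_on {0..1} (\<lambda>t. case (x,t) of (x,t) \<Rightarrow> B x t)"
          by (rule continuous_on_compose2[OF contB]) (use x in \<open>auto intro!: continuous_intros\<close>)
        then show ?thesis by (simp add: integrable_continuous_interval)
      qed
      have "((\<lambda>t. t * \<alpha> (p x t) k) has_vector_derivative F' x t k) (at t within {0..1})"
        if "t \<in> {0..1}" for t
      proof -
        note z = pS[OF x that]
        have dp: "((\<lambda>t. p x t) has_derivative (\<lambda>d. d *\<^sub>R (x - x0))) (at t within {0..1})"
          unfolding p_def by (auto intro!: derivative_eq_intros)
        have "((\<lambda>t. \<alpha> (p x t) k) has_derivative (\<lambda>d. \<beta> (p x t) k (d *\<^sub>R (x - x0)))) (at t within {0..1})"
          by (rule has_derivative_compose[OF dp deriv[OF z]])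
        then have "((\<lambda>t. t * \<alpha> (p x t) k) has_derivative
            (\<lambda>d. t * \<beta> (p x t) k (d *\<^sub>R (x - x0)) + d * \<alpha> (p x t) k)) (at t within {0..1})"
          by (intro has_derivative_mult) auto
        then show ?thesis
          unfolding has_vector_derivative_def
          by (rule has_derivative_eq_rhs)
            (auto simp: F'_def linear_scale[OF linb[OF z]] linear_scale[OF linb'[OF z]] sym[OF z, of k]
              mult.commute mult.left_commute add.commute distrib_left)
      qed
      then have "((\<lambda>t. F' x t k) has_integral (1 * \<alpha> (p x 1) k - 0 * \<alpha> (p x 0) k)) {0..1}"
        by (intro fundamental_theorem_of_calculus) auto
      then have "integral {0..1} (\<lambda>t. F' x t k) = \<alpha> x k"
        by (simp add: integral_unique p_def)
      moreover have "blinfun_apply (integral (cbox 0 1) (B x)) k = integral (cbox 0 1) (\<lambda>t. blinfun_apply (B x t) k)"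
        using integral_linear[OF Bx blinfun.bounded_linear_left[of k]] by (simp add: o_def)
      moreover have "integral (cbox 0 1) (\<lambda>t. blinfun_apply (B x t) k) = integral {0..1} (\<lambda>t. F' x t k)"
        unfolding cbox_interval by (rule integral_cong) (simp add: B[OF x])
      ultimately show ?thesis by simp
    qed
    then have "blinfun_apply (integral (cbox 0 1) (B x)) = \<alpha> x"
      by (rule ext)
    then show ?thesis
      using main x S(1) unfolding g_def by (simp add: at_within_open[of x S])
  qed
  then show ?thesis by blast
qed simp

section \<open>The torus and lifts to its universal cover\<close>

lemma abs_torus_eq_iff: "abs_torus x = abs_torus y \<longleftrightarrow> (\<forall>j. x $ j - y $ j \<in> \<int>)"
  by (simp add: torus.abs_eq_iff lattice_rel_def)

lemma continuous_on_abs_torus: "continuous_on UNIV (abs_torus :: real ^ 'n::finite \<Rightarrow> 'n torus)"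
  by (auto simp: continuous_on_open_vimage open_torus_def)

lemma continuous_on_cot_cover: "continuous_on S (cot_cover :: _ \<Rightarrow> 'n::finite cotangent)"
proof -
  have "continuous_on S (\<lambda>z :: (real^'n) \<times> (real^'n). (abs_torus (fst z), snd z))"
    by (intro continuous_on_Pair continuous_on_compose2[OF continuous_on_abs_torus] continuous_intros) auto
  then show ?thesis by (simp add: cot_cover_def[abs_def])
qed

lemma surj_abs_torus: "surj abs_torus"
  by (metis Quotient_torus Quotient_abs_rep surjI)

text \<open>
  The coordinate circles embed the torus in a product of punctured planes, so that lifting
  questions reduce to the existence of continuous logarithms of complex functions.
\<close>

lift_definition torus_circle :: "'n::finite \<Rightarrow> 'n torus \<Rightarrow> complex" is
  "\<lambda>j x. cis (2 * pi * x $ j)"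
proof -
  fix j and x y :: "real^'n" assume "lattice_rel x y"
  then obtain m :: int where m: "x $ j - y $ j = m" unfolding lattice_rel_def by (metis Ints_cases)
  have "cis (2 * pi * x $ j) = cis (2 * pi * y $ j + 2 * pi * m)"
    using m by (metis add.commute diff_add_cancel distrib_left)
  then show "cis (2 * pi * x $ j) = cis (2 * pi * y $ j)"
    by (simp add: cis_mult[symmetric] cis_multiple_2pi)
qed

lemma cis_2pi_eq_iff: "cis (2 * pi * a) = cis (2 * pi * b) \<longleftrightarrow> a - b \<in> \<int>"
proof
  assume "cis (2 * pi * a) = cis (2 * pi * b)"
  then obtain m :: int where "\<i> * complex_of_real (2 * pi * a) = \<i> * complex_of_real (2 * pi * b) + (of_int (2 * m) * pi) * \<i>"
    unfolding cis_conv_exp exp_eq by blast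
  then have "2 * pi * a = 2 * pi * b + 2 * m * pi"
    by (simp add: complex_eq_iff)
  then have "2 * pi * (a - b) = 2 * pi * m" by (simp add: algebra_simps)
  then have "a - b = m" by simp
  then show "a - b \<in> \<int>" by simp
next
  assume "a - b \<in> \<int>"
  then obtain m :: int where m: "a - b = m" by (metis Ints_cases)
  have "cis (2 * pi * a) = cis (2 * pi * b + 2 * pi * m)"
    using m by (metis add.commute diff_add_cancel distrib_left)
  then show "cis (2 * pi * a) = cis (2 * pi * b)"
    by (simp add: cis_mult[symmetric] cis_multiple_2pi)
qed

lemma torus_eqI: "(\<And>j. torus_circle j x = torus_circle j y) \<Longrightarrow> x = y"
  by transfer (simp add: lattice_rel_def cis_2pi_eq_iff)

lemma continuous_on_torus_circle: "continuous_on S (torus_circle j)"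
proof (rule continuous_on_subset)
  show "continuous_on UNIV (torus_circle j)"
    unfolding continuous_on_open_vimage[OF open_UNIV]
  proof (intro allI impI)
    fix B :: "complex set" assume "open B"
    have "continuous_on UNIV (\<lambda>x::real^'a. cis (2 * pi * x $ j))"
      by (intro continuous_intros)
    then have "open ((\<lambda>x::real^'a. cis (2 * pi * x $ j)) -` B)"
      using \<open>open B\<close> by (simp add: continuous_on_open_vimage)
    then show "open (torus_circle j -` B \<inter> UNIV)"
      by (simp add: open_torus_def vimage_def torus_circle.abs_eq)
  qed
qed simp

lemma continuous_Ints_valued_constant:
  fixes f :: "'a::topological_space \<Rightarrow> real"
  assumes "connected S" "continuous_on S f" "\<And>x. x \<in> S \<Longrightarrow> f x \<in> \<int>" "x \<in> S" "y \<in> S"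
  shows "f x = f y"
proof -
  have "f constant_on S"
  proof (rule continuous_discrete_range_constant[OF assms(1,2)])
    fix x assume "x \<in> S"
    have "1 \<le> norm (f y - f x)" if "y \<in> S" "f y \<noteq> f x" for y
    proof -
      have "f y - f x \<in> \<int>" using assms(3) \<open>x \<in> S\<close> that by auto
      then show ?thesis using Ints_nonzero_abs_ge1 that by fastforce
    qed
    then show "\<exists>e>0. \<forall>y. y \<in> S \<and> f y \<noteq> f x \<longrightarrow> e \<le> norm (f y - f x)"
      by (intro exI[of _ 1]) auto
  qed
  then show ?thesis using assms(4,5) by (auto simp: constant_on_def)
qed

text \<open>
  On a contractible set every coordinate circle has a continuous logarithm, whose imaginary part
  is \<open>2 * pi\<close> times the wanted coordinate of the lift.
\<close>

lemma torus_lift: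
  fixes f :: "'a::real_normed_vector \<Rightarrow> 'n::finite torus"
  assumes "continuous_on S f" "contractible S"
  obtains a where "continuous_on S a" "\<And>z. z \<in> S \<Longrightarrow> f z = abs_torus (a z)"
proof -
  have "\<exists>g. continuous_on S g \<and> (\<forall>z\<in>S. torus_circle j (f z) = exp (g z))" for j
  proof -
    have "continuous_on S (\<lambda>z. torus_circle j (f z))"
      by (rule continuous_on_compose2[OF continuous_on_torus_circle assms(1)]) auto
    moreover have "torus_circle j x \<noteq> 0" for x :: "'n torus"
      by transfer simp
    ultimately show ?thesis
      by (metis continuous_logarithm_on_contractible[OF _ assms(2)])
  qed
  then obtain g where g: "\<And>j. continuous_on S (g j)" "\<And>j z. z \<in> S \<Longrightarrow> torus_circle j (f z) = exp (g j z)"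
    by metis
  have norm1: "norm (torus_circle j x) = 1" for j and x :: "'n torus"
    by transfer simp
  define a where "a z = (\<chi> j. Im (g j z) / (2 * pi))" for z
  show thesis
  proof
    show "continuous_on S a"
      unfolding a_def by (intro continuous_intros g) auto
    fix z assume z: "z \<in> S"
    show "f z = abs_torus (a z)"
    proof (rule torus_eqI)
      fix j
      have "Re (g j z) = 0" using g(2)[OF z, of j] norm1[of j "f z"] by simp
      then have "exp (g j z) = cis (Im (g j z))" by (simp add: exp_eq_polar)
      then show "torus_circle j (f z) = torus_circle j (abs_torus (a z))"
        by (simp add: g(2)[OF z] torus_circle.abs_eq a_def)
    qed
  qed
qed

text \<open>
  The total displacement of a lifted loop is its homotopy class. Lift the whole homotopy: at
  each stage the displacement is an integer vector, so by continuity it stays the same, and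
  two lifts of one loop differ by a constant.
\<close>

lemma homotopic_loops_torus_lift:
  fixes a b :: "real \<Rightarrow> real ^ 'n::finite"
  assumes hom: "homotopic_loops UNIV p q"
    and a: "continuous_on {0..1} a" "\<And>t. t \<in> {0..1} \<Longrightarrow> p t = abs_torus (a t)"
    and b: "continuous_on {0..1} b" "\<And>t. t \<in> {0..1} \<Longrightarrow> q t = abs_torus (b t)"
  shows "a 1 - a 0 = b 1 - b 0"
proof -
  obtain h where h: "continuous_on ({0..1::real} \<times> {0..1::real}) h"
    and h0: "\<And>t. t \<in> {0..1} \<Longrightarrow> h (0,t) = p t" and h1: "\<And>t. t \<in> {0..1} \<Longrightarrow> h (1,t) = q t"
    and loop: "\<And>s. s \<in> {0..1} \<Longrightarrow> h (s,1) = h (s,0)"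
    using hom unfolding homotopic_loops by (auto simp: pathfinish_def pathstart_def)
  have "contractible ({0..1::real} \<times> {0..1::real})"
    by (intro convex_imp_contractible convex_Times) auto
  then obtain c where c: "continuous_on ({0..1} \<times> {0..1}) c"
    and hc: "\<And>z. z \<in> {0..1} \<times> {0..1} \<Longrightarrow> h z = abs_torus (c z)"
    by (rule torus_lift[OF h]) blast
  have cont1: "continuous_on {0..1} (\<lambda>s. c (s, t))" if "t \<in> {0..1}" for t
    by (rule continuous_on_compose2[OF c]) (use that in \<open>auto intro!: continuous_intros\<close>)
  have cont2: "continuous_on {0..1} (\<lambda>t. c (s, t))" if "s \<in> {0..1}" for s
    by (rule continuous_on_compose2[OF c]) (use that in \<open>auto intro!: continuous_intros\<close>)
  have same: "f 1 - f 0 = c (s,1) - c (s,0)"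
    if s: "s \<in> {0..1}" and f: "continuous_on {0..1} f" "\<And>t. t \<in> {0..1} \<Longrightarrow> h (s,t) = abs_torus (f t)"
    for s and f :: "real \<Rightarrow> real ^ 'n"
  proof (rule vec_eq_iff[THEN iffD2], rule allI)
    fix j
    have "f 0 $ j - c (s,0) $ j = f 1 $ j - c (s,1) $ j"
    proof (rule continuous_Ints_valued_constant[of "{0..1}" "\<lambda>t. f t $ j - c (s,t) $ j"])
      show "continuous_on {0..1} (\<lambda>t. f t $ j - c (s,t) $ j)"
        by (intro continuous_intros f cont2 s)
      fix t :: real assume "t \<in> {0..1}"
      then have "abs_torus (f t) = abs_torus (c (s,t))"
        using f(2) hc s by auto
      then show "f t $ j - c (s,t) $ j \<in> \<int>"
        by (simp add: abs_torus_eq_iff)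
    qed auto
    then show "(f 1 - f 0) $ j = (c (s,1) - c (s,0)) $ j" by simp
  qed
  have "(c (0,1) - c (0,0)) $ j = (c (1,1) - c (1,0)) $ j" for j
  proof (rule continuous_Ints_valued_constant[of "{0..1}" "\<lambda>s. (c (s,1) - c (s,0)) $ j"])
    show "continuous_on {0..1} (\<lambda>s. (c (s,1) - c (s,0)) $ j)"
      by (intro continuous_intros cont1) auto
    fix s :: real assume "s \<in> {0..1}"
    then have "abs_torus (c (s,1)) = abs_torus (c (s,0))"
      using loop[of s] hc[of "(s,1)"] hc[of "(s,0)"] by auto
    then show "(c (s,1) - c (s,0)) $ j \<in> \<int>"
      by (simp add: abs_torus_eq_iff)
  qed auto
  then have "c (0,1) - c (0,0) = c (1,1) - c (1,0)" by (simp add: vec_eq_iff)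
  then show ?thesis
    using same[of 0 a] same[of 1 b] a b h0 h1 by simp
qed

section \<open>Maps of class \<open>C\<^sup>k\<close>\<close>

text \<open>
  The constant \<open>c\<close> allows a global lift to be compared with the local lifts that witness smoothness
  of a map between cotangent bundles: the two agree only up to a lattice vector.
\<close>

lemma Ck_on_local:
  assumes "\<And>x. x \<in> S \<Longrightarrow> \<exists>N g c. open N \<and> x \<in> N \<and> Ck_on k N g \<and> (\<forall>y\<in>N. f y = g y + c)"
  shows "Ck_on k S f"
  using assms
proof (induction k arbitrary: f)
  case 0
  have "isCont f x" if "x \<in> S" for x
  proof -
    obtain N g c where N: "open N" "x \<in> N" "continuous_on N g" "\<forall>y\<in>N. f y = g y + c"
      using 0[OF \<open>x \<in> S\<close>] unfolding Ck_on.simps by blast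
    then have "continuous_on N f"
      by (metis (no_types, lifting) continuous_on_add continuous_on_const continuous_on_cong)
    then show ?thesis using N continuous_on_eq_continuous_at by blast
  qed
  then show ?case by (simp add: continuous_at_imp_continuous_on)
next
  case (Suc k)
  have *: "f differentiable at x \<and> (\<exists>N g. open N \<and> x \<in> N \<and> Ck_on k N (\<lambda>x. frechet_derivative g (at x) v) \<and>
       (\<forall>y\<in>N. frechet_derivative f (at y) v = frechet_derivative g (at y) v))" if "x \<in> S" for x v
  proof -
    obtain N g c where N: "open N" "x \<in> N" "\<forall>x\<in>N. g differentiable at x"
      "Ck_on k N (\<lambda>x. frechet_derivative g (at x) v)" "\<forall>y\<in>N. f y = g y + c"
      using Suc.prems[OF \<open>x \<in> S\<close>] unfolding Ck_on.simps by blast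
    have "(f has_derivative frechet_derivative g (at y)) (at y)" if "y \<in> N" for y
    proof -
      have "(g has_derivative frechet_derivative g (at y)) (at y)"
        using N that frechet_derivative_works by blast
      then have "((\<lambda>y. g y + c) has_derivative frechet_derivative g (at y)) (at y)"
        by (auto intro!: derivative_eq_intros)
      then show ?thesis
        by (rule has_derivative_transform_within_open[OF _ \<open>open N\<close> that]) (use N in auto)
    qed
    then show ?thesis
      using N by (metis differentiable_def frechet_derivative_at)
  qed
  have "Ck_on k S (\<lambda>x. frechet_derivative f (at x) v)" for v
  proof (rule Suc.IH)
    fix x assume "x \<in> S"
    then obtain N g where "open N" "x \<in> N" "Ck_on k N (\<lambda>x. frechet_derivative g (at x) v)"
      "\<forall>y\<in>N. frechet_derivative f (at y) v = frechet_derivative g (at y) v + 0"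
      using *[of x v] by auto
    then show "\<exists>N g c. open N \<and> x \<in> N \<and> Ck_on k N g \<and> (\<forall>y\<in>N. frechet_derivative f (at y) v = g y + c)"
      by blast
  qed
  then show ?case using * by simp
qed

lemma Ck_on_subset: "Ck_on k S f \<Longrightarrow> T \<subseteq> S \<Longrightarrow> Ck_on k T f"
  by (induction k arbitrary: f) (auto intro: continuous_on_subset)

lemma Ck_on_const: "Ck_on k S (\<lambda>x. c)"
  by (induction k arbitrary: c) auto

lemma Ck_on_id: "Ck_on k S (\<lambda>x. x)"
  by (cases k) (auto simp: Ck_on_const)

lemma Ck_on_1D:
  assumes "Ck_on (Suc k) S f"
  shows "z \<in> S \<Longrightarrow> (f has_derivative frechet_derivative f (at z)) (at z)"
    and "Ck_on k S (\<lambda>z. frechet_derivative f (at z) v)"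
  using assms frechet_derivative_works by auto

section \<open>Flux of symplectic maps\<close>

lemma symplectic_form_inner: "symplectic_form v w = fst v \<bullet> snd w - snd v \<bullet> fst w"
  by (simp add: symplectic_form_def inner_vec_def sum_subtractf)

text \<open>
  With the Liouville form \<open>\<lambda> = \<Sum> y\<^sub>i dx\<^sub>i\<close>, the form \<open>\<Phi>\<^sup>*\<lambda> - \<lambda>\<close> is closed because \<open>\<Phi>\<close> preserves
  \<open>d\<lambda>\<close>. In coordinates, the terms with first derivatives of \<open>\<Phi>\<close> are balanced by the symplectic
  condition and those with second derivatives by their symmetry. On a convex domain the form
  therefore has a primitive \<open>H\<close>.
\<close>

lemma symplectic_map_exact:
  fixes \<Phi> :: "(real ^ 'n::finite) \<times> (real ^ 'n) \<Rightarrow> (real ^ 'n) \<times> (real ^ 'n)"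
  assumes W: "open W" "convex W"
    and C2: "Ck_on (Suc (Suc 0)) W \<Phi>"
    and symp: "\<And>z v w. z \<in> W \<Longrightarrow>
      symplectic_form (frechet_derivative \<Phi> (at z) v) (frechet_derivative \<Phi> (at z) w) = symplectic_form v w"
  obtains H where "\<And>z. z \<in> W \<Longrightarrow>
    (H has_derivative (\<lambda>h. snd (\<Phi> z) \<bullet> fst (frechet_derivative \<Phi> (at z) h) - snd z \<bullet> fst h)) (at z)"
proof -
  define D where "D z = frechet_derivative \<Phi> (at z)" for z
  define D2 where "D2 z h = frechet_derivative (\<lambda>z. D z h) (at z)" for z h
  have D: "(\<Phi> has_derivative D z) (at z)" if "z \<in> W" for z
    using Ck_on_1D(1)[OF C2 that] by (simp add: D_def)
  have C1: "Ck_on (Suc 0) W (\<lambda>z. D z h)" for h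
    using Ck_on_1D(2)[OF C2] by (simp add: D_def)
  have D2: "((\<lambda>z. D z h) has_derivative D2 z h) (at z)" if "z \<in> W" for z h
    using Ck_on_1D(1)[OF C1 that] by (simp add: D2_def)
  have contD2: "continuous_on W (\<lambda>z. D2 z h k)" for h k
    using Ck_on_1D(2)[OF C1] by (simp add: D2_def)
  have contD: "continuous_on W (\<lambda>z. D z h)" for h
    using has_derivative_continuous[OF D2] by (intro continuous_at_imp_continuous_on ballI)
  have cont\<Phi>: "continuous_on W \<Phi>"
    using has_derivative_continuous[OF D] by (intro continuous_at_imp_continuous_on ballI)
  have D2_sym: "D2 z h k = D2 z k h" if "z \<in> W" for z h k
    by (rule symmetric_second_derivative[where f = \<Phi> and f' = D, OF W(1) that D D2 contD2])
  define \<alpha> where "\<alpha> z h = snd (\<Phi> z) \<bullet> fst (D z h) - snd z \<bullet> fst h" for z h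
  define \<beta> where "\<beta> z h k = snd (\<Phi> z) \<bullet> fst (D2 z h k) + snd (D z k) \<bullet> fst (D z h) - snd k \<bullet> fst h" for z h k
  have "\<exists>H. \<forall>z\<in>W. (H has_derivative \<alpha> z) (at z)"
  proof (rule closed_form_exact_on_convex[OF W])
    fix z assume z: "z \<in> W"
    note lin = has_derivative_linear[OF D[OF z]]
    show "linear (\<alpha> z)"
      by (rule linearI) (simp_all add: \<alpha>_def linear_add[OF lin] linear_scale[OF lin] algebra_simps inner_add_right)
    show "((\<lambda>z. \<alpha> z h) has_derivative \<beta> z h) (at z)" for h
      unfolding \<alpha>_def \<beta>_def
      by (intro has_derivative_diff has_derivative_inner has_derivative_fst has_derivative_snd
          has_derivative_inner_left D2 D z has_derivative_ident)
    show "\<beta> z h k = \<beta> z k h" for h k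
      using symp[OF z, of k h] D2_sym[OF z, of h k]
      by (simp add: \<beta>_def symplectic_form_inner D_def[symmetric] inner_commute)
  next
    show "continuous_on W (\<lambda>z. \<beta> z h k)" for h k
      unfolding \<beta>_def by (intro continuous_intros contD contD2 cont\<Phi>)
  qed
  then show thesis using that unfolding \<alpha>_def D_def by blast
qed

text \<open>
  Since \<open>\<Phi>\<close> commutes with the translation, \<open>\<Phi>\<^sup>*\<lambda> - \<lambda>\<close> is invariant under it, so the increment of a
  primitive has zero derivative. For a lattice vector \<open>e\<close> this constant is the flux, the period of
  \<open>\<Phi>\<^sup>*\<lambda> - \<lambda>\<close> over the loop covered by a segment in the direction \<open>e\<close>. That it does not vary with
  the fibre coordinate is the heart of the obstruction.
\<close>

lemma primitive_translation_constant:
  fixes \<Phi> :: "(real ^ 'n::finite) \<times> (real ^ 'n) \<Rightarrow> (real ^ 'n) \<times> (real ^ 'n)"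
  assumes W: "open W" "convex W" "\<And>z. z \<in> W \<Longrightarrow> z + (e, 0) \<in> W"
    and diff: "\<And>z. z \<in> W \<Longrightarrow> \<Phi> differentiable at z"
    and per: "\<And>z. z \<in> W \<Longrightarrow> \<Phi> (z + (e, 0)) = \<Phi> z + (e, 0)"
    and H: "\<And>z. z \<in> W \<Longrightarrow>
      (H has_derivative (\<lambda>h. snd (\<Phi> z) \<bullet> fst (frechet_derivative \<Phi> (at z) h) - snd z \<bullet> fst h)) (at z)"
  obtains C :: real where "\<And>z. z \<in> W \<Longrightarrow> H (z + (e, 0)) - H z = C"
proof -
  define T :: "(real ^ 'n) \<times> (real ^ 'n)" where "T = (e, 0)"
  have snd_T: "snd T = 0" by (simp add: T_def)
  have shift: "((\<lambda>w. F (w + T)) has_derivative F') (at z)"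
    if "(F has_derivative F') (at (z + T))" for z F' and F :: "(real ^ 'n) \<times> (real ^ 'n) \<Rightarrow> 'b::real_normed_vector"
    by (rule has_derivative_compose[where f = "\<lambda>w. w + T" and f' = "\<lambda>x. x", OF _ that])
      (auto intro!: derivative_eq_intros)
  have Deq: "frechet_derivative \<Phi> (at (z + T)) = frechet_derivative \<Phi> (at z)" if z: "z \<in> W" for z
  proof -
    have "(\<Phi> has_derivative frechet_derivative \<Phi> (at (z + T))) (at (z + T))"
      using diff[OF W(3)[OF z]] by (simp add: T_def frechet_derivative_works[symmetric])
    from shift[OF this]
    have "((\<lambda>w. \<Phi> (w + T) - T) has_derivative frechet_derivative \<Phi> (at (z + T))) (at z)"
      by (auto intro!: derivative_eq_intros)
    then have "(\<Phi> has_derivative frechet_derivative \<Phi> (at (z + T))) (at z)"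
      by (rule has_derivative_transform_within_open[OF _ W(1) z]) (simp add: per T_def)
    then show ?thesis by (rule frechet_derivative_at)
  qed
  have "((\<lambda>w. H (w + T) - H w) has_derivative (\<lambda>h. 0)) (at z within W)" if z: "z \<in> W" for z
  proof -
    have "z + T \<in> W" using W(3)[OF z] by (simp add: T_def)
    have "((\<lambda>w. H (w + T) - H w) has_derivative (\<lambda>h. 0)) (at z)"
      by (rule has_derivative_eq_rhs[OF has_derivative_diff[OF shift[OF H[OF \<open>z + T \<in> W\<close>]] H[OF z]]])
        (use per[OF z, folded T_def] in \<open>simp add: Deq[OF z] snd_T\<close>)
    then show ?thesis by (rule has_derivative_at_withinI)
  qed
  then obtain C where "\<forall>z\<in>W. H (z + T) - H z = C"
    using has_derivative_zero_constant[OF W(2)] by blast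
  then show thesis using that by (simp add: T_def)
qed

text \<open>
  A graph that is Lagrangian belongs to a closed one-form. The horizontal space at \<open>(x, u)\<close> is
  isotropic, and its image lies in the tangent space \<open>{(v, S' v)}\<close> of the graph. Injectivity of \<open>D\<close>
  and equality of dimensions make the image the whole tangent space, which is thus isotropic.
\<close>

lemma lagrangian_graph_symmetric:
  fixes \<Phi> :: "(real ^ 'n::finite) \<times> (real ^ 'n) \<Rightarrow> (real ^ 'n) \<times> (real ^ 'n)"
  assumes D: "(\<Phi> has_derivative D) (at (x, u))" and inj: "inj D"
    and symp: "\<And>v w. symplectic_form (D v) (D w) = symplectic_form v w"
    and S: "(S has_derivative S') (at (fst (\<Phi> (x, u))))"
    and graph: "\<And>x. snd (\<Phi> (x, u)) = S (fst (\<Phi> (x, u)))"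
  shows "S' v \<bullet> w = S' w \<bullet> v"
proof -
  have slice: "((\<lambda>x. \<Phi> (x, u)) has_derivative (\<lambda>h. D (h, 0))) (at x)"
    by (rule has_derivative_compose[where f = "\<lambda>x. (x, u)" and g = \<Phi>, OF _ D]) (auto intro!: derivative_eq_intros)
  define A where "A h = fst (D (h, 0))" for h
  have A: "((\<lambda>x. fst (\<Phi> (x, u))) has_derivative A) (at x)"
    unfolding A_def by (rule has_derivative_fst[OF slice])
  have "((\<lambda>x. snd (\<Phi> (x, u))) has_derivative (\<lambda>h. S' (A h))) (at x)"
    unfolding graph by (rule has_derivative_compose[OF A S])
  moreover have "((\<lambda>x. snd (\<Phi> (x, u))) has_derivative (\<lambda>h. snd (D (h, 0)))) (at x)"
    by (rule has_derivative_snd[OF slice])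
  ultimately have "(\<lambda>h. S' (A h)) = (\<lambda>h. snd (D (h, 0)))"
    by (rule has_derivative_unique)
  then have DA: "D (h, 0) = (A h, S' (A h))" for h
    by (metis A_def prod.collapse)
  have "inj A"
  proof (rule injI)
    fix h k assume "A h = A k"
    then have "D (h, 0) = D (k, 0)" by (simp add: DA)
    then show "h = k" using inj by (simp add: inj_eq)
  qed
  then have "surj A"
    using linear_injective_imp_surjective has_derivative_linear[OF A] by blast
  then obtain h k where "v = A h" "w = A k" by (metis surjD)
  then show ?thesis
    using symp[of "(h, 0)" "(k, 0)"] by (simp add: DA symplectic_form_inner inner_commute)
qed

section \<open>Lifting embeddings of cotangent domains\<close>

text \<open>
  A continuous lift exists because \<open>\<real>\<^sup>n \<times> \<Delta>\<close> is contractible. It is smooth because near each point it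
  differs from a smooth local lift by a continuous, hence constant, lattice vector.
\<close>

lemma cotangent_lift:
  fixes \<phi> :: "'n::finite cotangent \<Rightarrow> 'n cotangent"
  assumes \<Delta>: "open \<Delta>" "convex \<Delta>"
    and cont: "continuous_on (UNIV \<times> \<Delta>) \<phi>"
    and smooth: "smooth_map (UNIV \<times> \<Delta>) \<phi>"
  obtains \<Phi> where "\<And>z. z \<in> UNIV \<times> \<Delta> \<Longrightarrow> \<phi> (cot_cover z) = cot_cover (\<Phi> z)" "smooth_on (UNIV \<times> \<Delta>) \<Phi>"
proof -
  define W :: "((real^'n) \<times> (real^'n)) set" where "W = UNIV \<times> \<Delta>"
  have W: "open W" "convex W" unfolding W_def using \<Delta> by (auto intro: open_Times convex_Times)
  have cover: "cot_cover z \<in> UNIV \<times> \<Delta> \<longleftrightarrow> z \<in> W" for z :: "(real^'n) \<times> (real^'n)"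
    by (cases z) (simp add: W_def cot_cover_def)
  have contW: "continuous_on W (\<lambda>z. \<phi> (cot_cover z))"
    by (rule continuous_on_compose2[OF cont continuous_on_cot_cover]) (use cover in blast)
  have "continuous_on W (\<lambda>z. fst (\<phi> (cot_cover z)))"
    by (intro continuous_on_fst contW)
  from torus_lift[OF this convex_imp_contractible[OF W(2)]]
  obtain a where a: "continuous_on W a" "\<And>z. z \<in> W \<Longrightarrow> fst (\<phi> (cot_cover z)) = abs_torus (a z)"
    by blast
  define \<Phi> where "\<Phi> z = (a z, snd (\<phi> (cot_cover z)))" for z
  have lift: "\<phi> (cot_cover z) = cot_cover (\<Phi> z)" if "z \<in> W" for z
    using a(2)[OF that] by (simp add: \<Phi>_def cot_cover_def prod_eq_iff)
  have "\<exists>N f c. open N \<and> z \<in> N \<and> Ck_on k N f \<and> (\<forall>w\<in>N. \<Phi> w = f w + c)" if z: "z \<in> W" for z k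
  proof -
    obtain f N where N: "open N" "z \<in> N" "cot_cover ` N \<subseteq> UNIV \<times> \<Delta>" "smooth_on N f"
      and f: "\<And>w. w \<in> N \<Longrightarrow> \<phi> (cot_cover w) = cot_cover (f w)"
      using smooth z cover unfolding smooth_map_def smooth_lift_at_def by metis
    obtain d where d: "d > 0" "ball z d \<subseteq> N" using N openE by blast
    have BW: "ball z d \<subseteq> W" using d(2) N(3) cover by blast
    have "continuous_on N f" using N(4) unfolding smooth_on_def by (metis Ck_on.simps(1))
    then have contf: "continuous_on (ball z d) f" using d(2) continuous_on_subset by blast
    have eq: "cot_cover (\<Phi> w) = cot_cover (f w)" if "w \<in> ball z d" for w
      using lift f d(2) BW that by (metis subsetD)
    have "a w $ j - fst (f w) $ j = a z $ j - fst (f z) $ j" if "w \<in> ball z d" for w j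
    proof (rule continuous_Ints_valued_constant[of "ball z d" "\<lambda>w. a w $ j - fst (f w) $ j"])
      show "continuous_on (ball z d) (\<lambda>w. a w $ j - fst (f w) $ j)"
        using continuous_on_subset[OF a(1) BW] contf by (intro continuous_intros)
      show "a w $ j - fst (f w) $ j \<in> \<int>" if "w \<in> ball z d" for w
        using eq[OF that] by (simp add: cot_cover_def abs_torus_eq_iff \<Phi>_def)
    qed (use that d in auto)
    then have shift: "\<Phi> w = f w + (\<Phi> z - f z)" if "w \<in> ball z d" for w
      using that eq[OF that] eq[of z] d(1)
      by (auto simp: prod_eq_iff vec_eq_iff \<Phi>_def cot_cover_def algebra_simps)
    have "Ck_on k (ball z d) f"
      using N(4) d(2) Ck_on_subset unfolding smooth_on_def by blast
    moreover have "z \<in> ball z d" using d(1) by simp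
    ultimately show ?thesis using shift open_ball by blast
  qed
  then have "smooth_on W \<Phi>"
    unfolding smooth_on_def by (intro allI Ck_on_local)
  then show thesis using that lift by (simp add: W_def)
qed

text \<open>
  The segment from \<open>z\<close> to \<open>z + (e, 0)\<close> covers a loop, and triviality on free homotopy classes says
  that the image loop has the same displacement \<open>e\<close>.
\<close>

lemma pi1_trivial_lift_periodic:
  fixes \<phi> :: "'n::finite cotangent \<Rightarrow> 'n cotangent"
  assumes triv: "pi1_trivial (UNIV \<times> \<Delta>) \<phi>"
    and lift: "\<And>z. z \<in> UNIV \<times> \<Delta> \<Longrightarrow> \<phi> (cot_cover z) = cot_cover (\<Phi> z)"
    and cont: "continuous_on (UNIV \<times> \<Delta>) \<Phi>"
    and z: "z \<in> UNIV \<times> \<Delta>" and e: "\<And>j. e $ j \<in> \<int>"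
  shows "\<Phi> (z + (e, 0)) = \<Phi> z + (e, 0)"
proof -
  define c where "c t = z + (t *\<^sub>R e, 0)" for t :: real
  define \<gamma> where "\<gamma> t = cot_cover (c t)" for t
  have c: "c t \<in> UNIV \<times> \<Delta>" for t using z by (cases z) (simp add: c_def)
  have contc: "continuous_on S c" for S unfolding c_def by (intro continuous_intros)
  have "path \<gamma>"
    unfolding path_def \<gamma>_def
    by (rule continuous_on_compose2[OF continuous_on_cot_cover contc subset_UNIV])
  moreover have "path_image \<gamma> \<subseteq> UNIV \<times> \<Delta>"
  proof -
    have "\<gamma> t \<in> UNIV \<times> \<Delta>" for t
      using c[of t] by (cases "c t") (simp add: \<gamma>_def cot_cover_def)
    then show ?thesis unfolding path_image_def by (intro image_subsetI)
  qed
  moreover have c01: "\<gamma> 1 = \<gamma> 0"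
    using e by (simp add: \<gamma>_def c_def cot_cover_def abs_torus_eq_iff)
  ultimately have hom: "homotopic_loops UNIV (fst \<circ> \<phi> \<circ> \<gamma>) (fst \<circ> \<gamma>)"
    using triv unfolding pi1_trivial_def by (simp add: pathfinish_def pathstart_def)
  have contPc: "continuous_on {0..1} (\<lambda>t. \<Phi> (c t))"
    by (rule continuous_on_compose2[OF cont contc]) (use c in blast)
  have "fst (\<Phi> (c 1)) - fst (\<Phi> (c 0)) = fst (c 1) - fst (c 0)"
    by (rule homotopic_loops_torus_lift[OF hom, where a = "\<lambda>t. fst (\<Phi> (c t))" and b = "\<lambda>t. fst (c t)"])
      (auto intro!: continuous_intros contPc contc simp: \<gamma>_def lift[OF c], auto simp: cot_cover_def)
  moreover have "snd (\<Phi> (c 1)) = snd (\<Phi> (c 0))"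
    using c01 lift[OF c] by (metis \<gamma>_def cot_cover_def snd_conv)
  ultimately show ?thesis
    by (simp add: c_def prod_eq_iff algebra_simps zero_prod_def[symmetric])
qed

section \<open>Lagrangian sections and their periods\<close>

text \<open>
  Closedness of a section is first known only at the points that the lift \<open>\<Phi>\<close> reaches; periodicity
  carries it to the whole universal cover.
\<close>

lemma smooth_one_form_derivative_periodic:
  fixes \<sigma> :: "'n::finite torus \<Rightarrow> real ^ 'n"
  assumes S': "((\<lambda>y. \<sigma> (abs_torus y)) has_derivative S') (at a)" and eq: "abs_torus y = abs_torus a"
  shows "((\<lambda>y. \<sigma> (abs_torus y)) has_derivative S') (at y)"
proof -
  have "((\<lambda>w. \<sigma> (abs_torus (w + (a - y)))) has_derivative S') (at y)"
    by (rule has_derivative_compose[where f = "\<lambda>w. w + (a - y)" and f' = "\<lambda>x. x" and g = "\<lambda>y. \<sigma> (abs_torus y)"])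
      (auto intro!: derivative_eq_intros S' simp: algebra_simps)
  moreover have "abs_torus (w + (a - y)) = abs_torus w" for w
    using eq[symmetric] by (simp add: abs_torus_eq_iff)
  ultimately show ?thesis by simp
qed

text \<open>
  The image of the torus \<open>y = u\<close> is the graph of a closed form, with primitive \<open>g\<close> on the universal
  cover. Pulled back to the torus \<open>y = u\<close>, this form is \<open>\<Phi>\<^sup>*\<lambda>\<close>, so that the pullback of \<open>g\<close> and
  \<open>H + u \<bullet> x\<close> differ by a constant. Compare increments over the translation \<open>e\<close>: that of \<open>g\<close> is the
  increment of \<open>H\<close> plus \<open>u \<bullet> e\<close>. By the mean value theorem the increment of \<open>g\<close> is also a value
  taken by the component of the form in the direction \<open>e\<close>.
\<close>

lemma lagrangian_section_flux:
  fixes \<Phi> :: "(real ^ 'n::finite) \<times> (real ^ 'n) \<Rightarrow> (real ^ 'n) \<times> (real ^ 'n)"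
  assumes \<Phi>: "\<And>x. (\<Phi> has_derivative D x) (at (x, u))" and inj: "\<And>x. inj (D x)"
    and symp: "\<And>x v w. symplectic_form (D x v) (D x w) = symplectic_form v w"
    and H: "\<And>x. (H has_derivative (\<lambda>h. snd (\<Phi> (x, u)) \<bullet> fst (D x h) - u \<bullet> fst h)) (at (x, u))"
    and per: "\<Phi> (e, u) = \<Phi> (0, u) + (e, 0)"
    and sec: "smooth_section (range (\<lambda>x. cot_cover (\<Phi> (x, u))))"
  obtains x where "H (e, u) - H (0, u) + u \<bullet> e = snd (\<Phi> (x, u)) \<bullet> e"
proof -
  obtain \<sigma> where \<sigma>: "smooth_one_form \<sigma>"
    and graph: "range (\<lambda>x. cot_cover (\<Phi> (x, u))) = {(x, \<sigma> x) |x. x \<in> UNIV}"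
    using sec unfolding smooth_section_def by blast
  define S where "S y = \<sigma> (abs_torus y)" for y
  define S' where "S' y = frechet_derivative S (at y)" for y
  have C1: "Ck_on (Suc 0) UNIV S"
    using \<sigma> unfolding smooth_one_form_def smooth_on_def S_def by blast
  have S': "(S has_derivative S' y) (at y)" for y
    using Ck_on_1D(1)[OF C1] by (simp add: S'_def)
  have contS': "continuous_on UNIV (\<lambda>y. S' y h)" for h
    using Ck_on_1D(2)[OF C1] by (simp add: S'_def)
  have snd_eq: "snd (\<Phi> (x, u)) = S (fst (\<Phi> (x, u)))" for x
  proof -
    have "cot_cover (\<Phi> (x, u)) \<in> {(x, \<sigma> x) |x. x \<in> UNIV}" using graph by blast
    then show ?thesis by (auto simp: cot_cover_def S_def)
  qed
  have onto: "\<exists>x. abs_torus y = abs_torus (fst (\<Phi> (x, u))) \<and> S y = snd (\<Phi> (x, u))" for y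
  proof -
    have "(abs_torus y, S y) \<in> range (\<lambda>x. cot_cover (\<Phi> (x, u)))" unfolding graph S_def by blast
    then show ?thesis by (auto simp: cot_cover_def)
  qed
  have S'_sym: "S' y h \<bullet> k = S' y k \<bullet> h" for y h k
  proof -
    obtain x where x: "abs_torus y = abs_torus (fst (\<Phi> (x, u)))" using onto by blast
    have "(S has_derivative S' y) (at (fst (\<Phi> (x, u))))"
      using smooth_one_form_derivative_periodic[OF S'[of y, unfolded S_def[abs_def]] x[symmetric]]
      by (simp add: S_def[abs_def])
    from lagrangian_graph_symmetric[OF \<Phi> inj symp this snd_eq] show ?thesis .
  qed
  have "\<exists>g. \<forall>y\<in>UNIV. (g has_derivative (\<lambda>h. S y \<bullet> h)) (at y)"
  proof (rule closed_form_exact_on_convex[OF open_UNIV convex_UNIV])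
    show "linear (\<lambda>h. S y \<bullet> h)" for y by (rule linearI) (simp_all add: inner_add_right)
    show "((\<lambda>y. S y \<bullet> h) has_derivative (\<lambda>k. S' y k \<bullet> h)) (at y)" for y h
      by (rule has_derivative_inner_left[OF S'])
    show "continuous_on UNIV (\<lambda>y. S' y k \<bullet> h)" for h k
      by (intro continuous_intros contS')
  qed (rule S'_sym)
  then obtain g where g: "\<And>y. (g has_derivative (\<lambda>h. S y \<bullet> h)) (at y)" by blast
  define K where "K x = g (fst (\<Phi> (x, u))) - H (x, u) - u \<bullet> x" for x
  have "(K has_derivative (\<lambda>h. 0)) (at x within UNIV)" for x
  proof -
    have i: "((\<lambda>x. (x, u)) has_derivative (\<lambda>h. (h, 0))) (at x)" by (auto intro!: derivative_eq_intros)
    have "((\<lambda>x. fst (\<Phi> (x, u))) has_derivative (\<lambda>h. fst (D x (h, 0)))) (at x)"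
      by (rule has_derivative_fst[OF has_derivative_compose[OF i \<Phi>]])
    then have "((\<lambda>x. g (fst (\<Phi> (x, u)))) has_derivative (\<lambda>h. S (fst (\<Phi> (x, u))) \<bullet> fst (D x (h, 0)))) (at x)"
      by (rule has_derivative_compose[OF _ g])
    moreover have "((\<lambda>x. H (x, u)) has_derivative
        (\<lambda>h. snd (\<Phi> (x, u)) \<bullet> fst (D x (h, 0)) - u \<bullet> fst (h, 0::real^'n))) (at x)"
      by (rule has_derivative_compose[OF i H])
    ultimately show ?thesis
      unfolding K_def
      by (auto intro!: derivative_eq_intros simp: snd_eq[symmetric])
  qed
  then have "K e = K 0"
    by (intro has_derivative_zero_unique[OF convex_UNIV]) auto
  then have flux: "H (e, u) - H (0, u) + u \<bullet> e = g (fst (\<Phi> (0, u)) + e) - g (fst (\<Phi> (0, u)))"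
    by (simp add: K_def per)
  have "\<exists>t\<in>{0<..<1}. g (fst (\<Phi> (0, u)) + 1 *\<^sub>R e) - g (fst (\<Phi> (0, u)) + 0 *\<^sub>R e)
      = (1 - 0) * (S (fst (\<Phi> (0, u)) + t *\<^sub>R e) \<bullet> e)"
  proof (rule mvt_simple)
    fix t :: real
    have "((\<lambda>t. g (fst (\<Phi> (0, u)) + t *\<^sub>R e)) has_derivative
        (\<lambda>d. S (fst (\<Phi> (0, u)) + t *\<^sub>R e) \<bullet> (d *\<^sub>R e))) (at t within {0..1})"
      by (rule has_derivative_compose[where f = "\<lambda>t. fst (\<Phi> (0, u)) + t *\<^sub>R e" and g = g, OF _ g])
        (auto intro!: derivative_eq_intros)
    then show "((\<lambda>t. g (fst (\<Phi> (0, u)) + t *\<^sub>R e)) has_derivative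
        (\<lambda>d. d * (S (fst (\<Phi> (0, u)) + t *\<^sub>R e) \<bullet> e))) (at t within {0..1})" by simp
  qed simp
  then obtain y where "g (fst (\<Phi> (0, u)) + e) - g (fst (\<Phi> (0, u))) = S y \<bullet> e" by auto
  then show thesis using that flux onto[of y] by metis
qed

text \<open>
  Every fibre coordinate \<open>u $ i\<close> that occurs in the domain occurs, up to one common shift \<open>C\<close>, as a
  fibre coordinate in the target: as the Lagrangian tori move with \<open>u\<close>, the periods of their
  images move by exactly the same amount.
\<close>

lemma symplectic_embedding_flux_constant:
  fixes \<phi> :: "'n::finite cotangent \<Rightarrow> 'n cotangent"
  assumes \<Delta>: "open \<Delta>" "convex \<Delta>"
    and symp: "symplectic_embedding (UNIV \<times> \<Delta>) V \<phi>"
    and triv: "pi1_trivial (UNIV \<times> \<Delta>) \<phi>"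
    and sec: "\<And>u. u \<in> \<Delta> \<Longrightarrow> smooth_section (\<phi> ` (UNIV \<times> {u}))"
  obtains C :: real where "\<And>u. u \<in> \<Delta> \<Longrightarrow> \<exists>p\<in>V. snd p $ i = u $ i + C"
proof -
  define W :: "((real^'n) \<times> (real^'n)) set" where "W = UNIV \<times> \<Delta>"
  define e :: "real^'n" where "e = axis i 1"
  have W: "open W" "convex W" unfolding W_def using \<Delta> by (auto intro: open_Times convex_Times)
  have W_shift: "z + (e, 0) \<in> W" if "z \<in> W" for z
    using that by (cases z) (simp add: W_def)
  have cover: "cot_cover z \<in> UNIV \<times> \<Delta> \<longleftrightarrow> z \<in> W" for z :: "(real^'n) \<times> (real^'n)"
    by (cases z) (simp add: W_def cot_cover_def)
  have emb: "smooth_embedding (UNIV \<times> \<Delta>) V \<phi>"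
    using symp by (simp add: symplectic_embedding_def)
  have smooth\<phi>: "smooth_map (UNIV \<times> \<Delta>) \<phi>" and into: "\<phi> ` (UNIV \<times> \<Delta>) \<subseteq> V"
    using emb by (simp_all add: smooth_embedding_def)
  have cont\<phi>: "continuous_on (UNIV \<times> \<Delta>) \<phi>"
    using emb unfolding smooth_embedding_def homeomorphism_def by (elim conjE exE)
  obtain \<Phi> where lift: "\<And>z. z \<in> W \<Longrightarrow> \<phi> (cot_cover z) = cot_cover (\<Phi> z)" and smooth: "smooth_on W \<Phi>"
    using cotangent_lift[OF \<Delta> cont\<phi> smooth\<phi>] unfolding W_def by metis
  define D where "D z = frechet_derivative \<Phi> (at z)" for z
  have C2: "Ck_on (Suc (Suc 0)) W \<Phi>" using smooth unfolding smooth_on_def by blast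
  have D: "(\<Phi> has_derivative D z) (at z)" if "z \<in> W" for z
    using Ck_on_1D(1)[OF C2 that] by (simp add: D_def)
  have tangent: "has_tangent_map (UNIV \<times> \<Delta>) \<phi> z (D z)" if "z \<in> W" for z
  proof -
    have "cot_cover ` W \<subseteq> UNIV \<times> \<Delta>" using cover by blast
    then show ?thesis
      unfolding has_tangent_map_def smooth_lift_at_def using W(1) that smooth lift D by blast
  qed
  have injD: "inj (D z)" if "z \<in> W" for z
  proof -
    have "\<forall>z D. cot_cover z \<in> UNIV \<times> \<Delta> \<longrightarrow> has_tangent_map (UNIV \<times> \<Delta>) \<phi> z D \<longrightarrow> inj D"
      using emb unfolding smooth_embedding_def by (elim conjE)
    moreover have "cot_cover z \<in> UNIV \<times> \<Delta>" using cover that by blast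
    ultimately show ?thesis using tangent[OF that] by (elim allE impE)
  qed
  have sympD: "symplectic_form (D z v) (D z w) = symplectic_form v w" if "z \<in> W" for z v w
  proof -
    have "\<forall>z D. cot_cover z \<in> UNIV \<times> \<Delta> \<longrightarrow> has_tangent_map (UNIV \<times> \<Delta>) \<phi> z D \<longrightarrow>
        (\<forall>v w. symplectic_form (D v) (D w) = symplectic_form v w)"
      using symp unfolding symplectic_embedding_def by (elim conjE)
    moreover have "cot_cover z \<in> UNIV \<times> \<Delta>" using cover that by blast
    ultimately show ?thesis using tangent[OF that] by (elim allE impE)
  qed
  have cont\<Phi>: "continuous_on W \<Phi>"
    using smooth unfolding smooth_on_def by (metis Ck_on.simps(1))
  have per: "\<Phi> (z + (e, 0)) = \<Phi> z + (e, 0)" if "z \<in> W" for z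
  proof (rule pi1_trivial_lift_periodic[OF triv])
    show "e $ j \<in> \<int>" for j by (simp add: e_def axis_def)
  qed (use lift cont\<Phi> that in \<open>auto simp: W_def\<close>)
  obtain H where H: "\<And>z. z \<in> W \<Longrightarrow>
      (H has_derivative (\<lambda>h. snd (\<Phi> z) \<bullet> fst (frechet_derivative \<Phi> (at z) h) - snd z \<bullet> fst h)) (at z)"
    by (rule symplectic_map_exact[OF W C2 sympD[unfolded D_def]]) (assumption, rule that)
  obtain C where C: "\<And>z. z \<in> W \<Longrightarrow> H (z + (e, 0)) - H z = C"
  proof (rule primitive_translation_constant[OF W W_shift _ per H])
    show "\<Phi> differentiable at z" if "z \<in> W" for z using D[OF that] by (rule differentiableI)
  qed (assumption | rule that)+
  show thesis
  proof
    fix u assume u: "u \<in> \<Delta>"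
    then have xu: "(x, u) \<in> W" for x by (simp add: W_def)
    have range: "range (\<lambda>x. cot_cover (\<Phi> (x, u))) = \<phi> ` (UNIV \<times> {u})"
    proof -
      have "range (\<lambda>x. cot_cover (\<Phi> (x, u))) = \<phi> ` range (\<lambda>x. cot_cover (x, u))"
        by (simp add: image_image lift[OF xu])
      also have "range (\<lambda>x. cot_cover (x, u)) = UNIV \<times> {u}"
      proof -
        have "range (\<lambda>x. cot_cover (x, u)) = (\<lambda>p. (p, u)) ` range abs_torus"
          by (simp add: cot_cover_def image_image)
        also have "range abs_torus = UNIV" by (rule surj_abs_torus)
        finally show ?thesis by auto
      qed
      finally show ?thesis .
    qed
    obtain x where x: "H (e, u) - H (0, u) + u \<bullet> e = snd (\<Phi> (x, u)) \<bullet> e"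
    proof (rule lagrangian_section_flux[of \<Phi> "\<lambda>x. D (x, u)" u H e])
      show "(\<Phi> has_derivative D (x, u)) (at (x, u))" "inj (D (x, u))" for x using D injD xu by auto
      show "symplectic_form (D (x, u) v) (D (x, u) w) = symplectic_form v w" for x v w using sympD xu by auto
      show "(H has_derivative (\<lambda>h. snd (\<Phi> (x, u)) \<bullet> fst (D (x, u) h) - u \<bullet> fst h)) (at (x, u))" for x
        using H[OF xu[of x]] by (simp add: D_def)
      show "\<Phi> (e, u) = \<Phi> (0, u) + (e, 0)" using per[OF xu[of 0]] by simp
      show "smooth_section (range (\<lambda>x. cot_cover (\<Phi> (x, u))))" using sec[OF u] by (simp add: range)
    qed blast
    have "H (e, u) - H (0, u) = C" using C[OF xu[of 0]] by simp
    then have "snd (\<Phi> (x, u)) $ i = u $ i + C"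
      using x by (simp add: e_def inner_axis)
    moreover have "cot_cover (\<Phi> (x, u)) \<in> V"
      using range into u by blast
    ultimately show "\<exists>p\<in>V. snd p $ i = u $ i + C"
      by (metis cot_cover_def snd_conv)
  qed
qed

section \<open>The inclusion\<close>

text \<open>
  Every local lift of the identity differs from the identity by a locally constant lattice vector,
  so the identity is the only tangent map.
\<close>

lemma symplectic_embedding_id:
  fixes U :: "'n::finite cotangent set"
  assumes "open U" "U \<subseteq> V"
  shows "symplectic_embedding U V (\<lambda>x. x)"
proof -
  have open_cover: "open (cot_cover -` U)"
    using continuous_on_cot_cover[of "UNIV :: ((real^'n) \<times> (real^'n)) set"] assms(1) by (simp add: continuous_on_open_vimage)
  have "smooth_map U (\<lambda>x. x)"
    unfolding smooth_map_def smooth_lift_at_def smooth_on_def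
  proof (intro allI impI)
    fix z :: "(real^'n) \<times> (real^'n)" assume "cot_cover z \<in> U"
    then show "\<exists>f N. open N \<and> z \<in> N \<and> cot_cover ` N \<subseteq> U \<and> (\<forall>k. Ck_on k N f) \<and>
        (\<forall>w\<in>N. cot_cover w = cot_cover (f w))"
      using open_cover Ck_on_id by (intro exI[of _ "\<lambda>x. x"] exI[of _ "cot_cover -` U"]) auto
  qed
  moreover have tangent: "D = (\<lambda>x. x)" if tangent: "has_tangent_map U (\<lambda>x. x) z D" for z D
  proof -
    obtain f N where N: "open N" "z \<in> N" "smooth_on N f" "\<And>w. w \<in> N \<Longrightarrow> cot_cover w = cot_cover (f w)"
      and f: "(f has_derivative D) (at z)"
      using tangent unfolding has_tangent_map_def smooth_lift_at_def by blast
    obtain d where d: "d > 0" "ball z d \<subseteq> N" using N openE by blast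
    have "continuous_on N f" using N(3) unfolding smooth_on_def by (metis Ck_on.simps(1))
    then have contf: "continuous_on (ball z d) f" using d(2) continuous_on_subset by blast
    have shift: "w + (f z - z) = f w" if w: "w \<in> ball z d" for w
    proof -
      have eq: "cot_cover w = cot_cover (f w)" if "w \<in> ball z d" for w using N(4) d(2) that by blast
      have "fst (f w) $ j - fst w $ j = fst (f z) $ j - fst z $ j" for j
      proof (rule continuous_Ints_valued_constant[of "ball z d" "\<lambda>w. fst (f w) $ j - fst w $ j"])
        show "continuous_on (ball z d) (\<lambda>w. fst (f w) $ j - fst w $ j)"
          by (intro continuous_intros contf)
        show "fst (f w) $ j - fst w $ j \<in> \<int>" if "w \<in> ball z d" for w
          using eq[OF that, symmetric] by (simp add: cot_cover_def abs_torus_eq_iff)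
      qed (use w d in auto)
      then show ?thesis
        using eq[OF w] eq[of z] d(1)
        by (auto simp: prod_eq_iff vec_eq_iff cot_cover_def algebra_simps)
    qed
    have "((\<lambda>w. w + (f z - z)) has_derivative (\<lambda>x. x)) (at z)"
      by (auto intro!: derivative_eq_intros)
    then have "(f has_derivative (\<lambda>x. x)) (at z)"
      by (rule has_derivative_transform_within_open[OF _ open_ball[of z d]]) (use d(1) shift in auto)
    then show ?thesis using f has_derivative_unique by blast
  qed
  moreover have "homeomorphism U U (\<lambda>x. x) (\<lambda>x. x)"
    by (simp add: homeomorphism_def)
  ultimately show ?thesis
    unfolding symplectic_embedding_def smooth_embedding_def
    using assms(2) by (auto simp: inj_def)
qed

lemma pi1_trivial_id: "pi1_trivial (U :: 'n::finite cotangent set) (\<lambda>x. x)"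
  unfolding pi1_trivial_def
proof (intro allI impI, elim conjE)
  fix \<gamma> :: "real \<Rightarrow> 'n cotangent"
  assume "path \<gamma>" "path_image \<gamma> \<subseteq> U" "pathfinish \<gamma> = pathstart \<gamma>"
  then show "homotopic_loops UNIV (fst \<circ> (\<lambda>x. x) \<circ> \<gamma>) (fst \<circ> \<gamma>)"
    by (auto simp: homotopic_loops_refl o_def path_def pathfinish_def pathstart_def intro: continuous_on_fst)
qed

lemma smooth_section_const: "smooth_section (UNIV \<times> {u})"
  unfolding smooth_section_def smooth_one_form_def smooth_on_def
  by (intro exI[of _ "\<lambda>x. u"]) (auto simp: Ck_on_const)

section \<open>The width of the simplex\<close>

lemma open_simplex_eq:
  assumes "s > 0"
  shows "(open_simplex s :: (real ^ 'n::finite) set) = {y. (\<forall>j. 0 < y $ j) \<and> (\<Sum>j\<in>UNIV. y $ j) < s}"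
proof -
  have Basis_eq: "(Basis :: (real ^ 'n) set) = range (\<lambda>j. axis j 1)"
    by (auto simp: Basis_vec_def)
  have inj: "inj (\<lambda>j::'n. axis j (1::real))"
    by (auto simp: inj_def axis_eq_axis)
  have "insert 0 (range (\<lambda>j::'n. axis j s)) = (\<lambda>x. s *\<^sub>R x) ` insert 0 Basis"
    by (force simp: Basis_eq image_image vec_eq_iff axis_def)
  then have "(open_simplex s :: (real ^ 'n) set) = (\<lambda>x. s *\<^sub>R x) ` interior (convex hull (insert 0 Basis))"
    using assms by (simp add: open_simplex_def convex_hull_scaling interior_injective_linear_image inj_on_def
        del: image_insert)
  also have "\<dots> = (\<lambda>x. s *\<^sub>R x) ` {y::real^'n. (\<forall>j. 0 < y $ j) \<and> (\<Sum>j\<in>UNIV. y $ j) < 1}"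
    unfolding interior_std_simplex unfolding Basis_eq
    by (simp add: sum.reindex[OF inj] inner_axis)
  also have "\<dots> = {y. (\<forall>j. 0 < y $ j) \<and> (\<Sum>j\<in>UNIV. y $ j) < s}" (is "_ ` ?A = ?B")
  proof (intro equalityI subsetI)
    fix y assume "y \<in> ?B"
    then have "(1/s) *\<^sub>R y \<in> ?A"
      using assms by (auto simp: sum_divide_distrib[symmetric])
    moreover have "y = s *\<^sub>R ((1/s) *\<^sub>R y)" using assms by simp
    ultimately show "y \<in> (\<lambda>x. s *\<^sub>R x) ` ?A" by blast
  next
    fix y assume "y \<in> (\<lambda>x. s *\<^sub>R x) ` ?A"
    then show "y \<in> ?B"
      using assms by (auto simp: sum_distrib_left[symmetric])
  qed
  finally show ?thesis .
qed

lemma simplex_in_strip_imp_le: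
  assumes "s > 0"
    and strip: "\<And>u :: real ^ 'n::finite. u \<in> open_simplex s \<Longrightarrow> 0 < u $ i + C \<and> u $ i + C < r"
  shows "s \<le> r"
proof (rule field_le_epsilon)
  fix \<epsilon> :: real assume "\<epsilon> > 0"
  define n where "n = real CARD('n)"
  have n: "n \<ge> 1" by (simp add: n_def Suc_leI)
  \<comment> \<open>The points \<open>u\<close> and \<open>v\<close> below lie in the simplex, and their coordinates with index \<open>i\<close> differ by
    \<open>s - (n + 1) * d\<close>.\<close>
  define d where "d = (min \<epsilon> s / 2) / (n + 1)"
  have d: "d > 0" "(n + 1) * d < s" "(n + 1) * d < \<epsilon>"
  proof -
    show "d > 0" using assms(1) \<open>\<epsilon> > 0\<close> n by (simp add: d_def)
    have "n + 1 \<noteq> 0" using n by simp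
    then have "(n + 1) * d = min \<epsilon> s / 2" unfolding d_def by (rule nonzero_mult_div_cancel_left[of _ "min \<epsilon> s / 2", unfolded times_divide_eq_right[symmetric]])
    then show "(n + 1) * d < s" "(n + 1) * d < \<epsilon>" using assms(1) \<open>\<epsilon> > 0\<close> by linarith+
  qed
  define u :: "real ^ 'n" where "u = (\<chi> j. d)"
  define v :: "real ^ 'n" where "v = (\<chi> j. if j = i then s - n * d else d)"
  have "(\<Sum>j\<in>UNIV. v $ j) = (s - n * d) + (\<Sum>j\<in>UNIV - {i}. d)"
    by (subst sum.remove[of _ i]) (auto simp: v_def)
  also have "\<dots> = s - d"
    using n by (simp add: n_def algebra_simps of_nat_diff)
  finally have "v \<in> open_simplex s"
    using d by (simp add: open_simplex_eq[OF assms(1)] v_def algebra_simps)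
  moreover have "u \<in> open_simplex s"
    using d by (simp add: open_simplex_eq[OF assms(1)] u_def n_def algebra_simps)
  ultimately have "s - n * d + C < r" "0 < d + C"
    using strip[of v] strip[of u] by (simp_all add: u_def v_def)
  then show "s \<le> r + \<epsilon>" using d(3) by (simp add: algebra_simps)
qed

section \<open>The embedding criterion\<close>

theorem theorem1p16:
  fixes r s :: real and i :: "'n::finite"
  assumes "r > 0" and "s > 0"
  shows "(\<exists>\<phi> :: 'n cotangent \<Rightarrow> 'n cotangent.
            symplectic_embedding (P_domain s) (Y_domain i r) \<phi> \<and>
            pi1_trivial (P_domain s) \<phi> \<and>
            (\<forall>u \<in> open_simplex s. smooth_section (\<phi> ` (UNIV \<times> {u}))))
         \<longleftrightarrow> s \<le> r"
proof
  assume "\<exists>\<phi> :: 'n cotangent \<Rightarrow> 'n cotangent.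
            symplectic_embedding (P_domain s) (Y_domain i r) \<phi> \<and>
            pi1_trivial (P_domain s) \<phi> \<and>
            (\<forall>u \<in> open_simplex s. smooth_section (\<phi> ` (UNIV \<times> {u})))"
  then obtain \<phi> :: "'n cotangent \<Rightarrow> 'n cotangent"
    where \<phi>: "symplectic_embedding (UNIV \<times> open_simplex s) (Y_domain i r) \<phi>"
      "pi1_trivial (UNIV \<times> open_simplex s) \<phi>"
      "\<And>u. u \<in> open_simplex s \<Longrightarrow> smooth_section (\<phi> ` (UNIV \<times> {u}))"
    unfolding P_domain_def by blast
  have "open (open_simplex s :: (real ^ 'n) set)" "convex (open_simplex s :: (real ^ 'n) set)"
    by (simp_all add: open_simplex_def convex_interior)
  from symplectic_embedding_flux_constant[OF this \<phi>, of i]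
  obtain C where "\<And>u. u \<in> open_simplex s \<Longrightarrow> \<exists>p\<in>Y_domain i r. snd p $ i = u $ i + C"
    by blast
  then show "s \<le> r"
    by (intro simplex_in_strip_imp_le[OF assms(2), of i C]) (fastforce simp: Y_domain_def)
next
  assume "s \<le> r"
  have "P_domain s \<subseteq> Y_domain i r"
  proof -
    have "u $ i < r" if "\<forall>j. 0 < u $ j" "(\<Sum>j\<in>UNIV. u $ j) < s" for u :: "real ^ 'n"
    proof -
      have "u $ i \<le> (\<Sum>j\<in>UNIV. u $ j)"
        using that(1) by (intro member_le_sum) (auto intro: less_imp_le)
      then show ?thesis using that(2) \<open>s \<le> r\<close> by linarith
    qed
    then show ?thesis by (auto simp: P_domain_def Y_domain_def open_simplex_eq[OF assms(2)])
  qed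
  moreover have "open (P_domain s :: 'n cotangent set)"
    by (auto simp: P_domain_def open_simplex_def intro: open_Times)
  ultimately have "symplectic_embedding (P_domain s) (Y_domain i r) (\<lambda>x. x)"
    by (intro symplectic_embedding_id)
  then show "\<exists>\<phi> :: 'n cotangent \<Rightarrow> 'n cotangent.
            symplectic_embedding (P_domain s) (Y_domain i r) \<phi> \<and>
            pi1_trivial (P_domain s) \<phi> \<and>
            (\<forall>u \<in> open_simplex s. smooth_section (\<phi> ` (UNIV \<times> {u})))"
    by (intro exI[of _ "\<lambda>x. x"]) (simp add: pi1_trivial_id smooth_section_const)
qed

end
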